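(* Let $n\ge0$ be an integer and let $y=(y_0,\dots,y_n)\in[0,\infty)^{n+1}$ with $y_0>0$. Then the problem of minimizing $\mathcal{I}(x)=\mathcal{I}(y\|x*x)$ over $x\in[0,\infty)^{n+1}$ admits a solution, i.e. there exists $x^\star\in[0,\infty)^{n+1}$ with $\mathcal{I}(x^\star)\le\mathcal{I}(x)$ for all $x\in[0,\infty)^{n+1}$.
   Context: For $x=(x_0,\dots,x_n)\in[0,\infty)^{n+1}$ let $(x*x)_i=\sum_{j=0}^i x_{i-j}x_j$, $i=0,\dots,n$, and view $x*x$ as a vector in $\mathbb{R}^{n+1}$. The $\mathcal{I}$-divergence of nonnegative vectors $u,v$ of equal length is $\mathcal{I}(u\|v)=\sum_i\big(u_i\log\frac{u_i}{v_i}-u_i+v_i\big)$ (with $0\log 0=0\log\frac00=0$) if $u_i=0$ whenever $v_i=0$, and $+\infty$ if there is an index $i$ with $u_i>0$ and $v_i=0$. So $\mathcal{I}(x)=\sum_{i=0}^n\big(y_i\log\frac{y_i}{(x*x)_i}-y_i+(x*x)_i\big)$. *)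

theory Defs
  imports "HOL-Analysis.Analysis"
begin

text \<open>A vector in \<open>[0,\<infinity>)\<close> to the power \<open>n + 1\<close> is an extensional function on the index set
  \<open>{0,\<dots>,n}\<close>, i.e. it takes the value \<^const>\<open>undefined\<close> outside \<open>{..n}\<close>.\<close>

definition nonneg_vectors :: "nat \<Rightarrow> (nat \<Rightarrow> real) set" where
  "nonneg_vectors n = {..n} \<rightarrow>\<^sub>E {0..}"

definition self_conv :: "nat \<Rightarrow> (nat \<Rightarrow> real) \<Rightarrow> (nat \<Rightarrow> real)" where
  "self_conv n x = (\<lambda>i\<in>{..n}. \<Sum>j=0..i. x (i - j) * x j)"

text \<open>The conventions \<open>0 log 0 = 0 log (0/0) = 0\<close> hold automatically, since a summand with
  \<open>u i = 0\<close> has the factor \<open>0\<close> in front of the (total) logarithm.\<close>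

definition I_divergence :: "nat \<Rightarrow> (nat \<Rightarrow> real) \<Rightarrow> (nat \<Rightarrow> real) \<Rightarrow> ereal" where
  "I_divergence n u v =
    (if \<forall>i\<le>n. v i = 0 \<longrightarrow> u i = 0
     then ereal (\<Sum>i=0..n. u i * ln (u i / v i) - u i + v i)
     else \<infinity>)"

end

theory Submission
  imports Defs
begin

text \<open>The divergence is coercive and, on suitable compact sets, continuous. Every summand
  \<open>u ln (u/v) - u + v\<close> is nonnegative, so a bound \<open>M\<close> on the whole divergence is a bound on each
  summand. Such a bound confines \<open>v\<close> from above, because \<open>v\<close> beats the logarithm
  (\<open>divergence_term_ge_linear\<close>), and, when \<open>u > 0\<close>, also from below by a positive constant, because
  the logarithm blows up at \<open>v = 0\<close> (\<open>divergence_term_le_imp_lower\<close>).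

  Take for \<open>M\<close> the (finite) divergence of the vector \<open>(1,\<dots>,1)\<close> and suppose that \<open>x\<close> has divergence
  at most \<open>M\<close>. The entries of \<open>x * x\<close> are then bounded, and since \<open>y\<^sub>0 > 0\<close> the entry
  \<open>(x * x)\<^sub>0 = x\<^sub>0\<^sup>2\<close> stays away from \<open>0\<close>. As \<open>x\<^sub>0 x\<^sub>i \<le> (x * x)\<^sub>i\<close>, all entries of \<open>x\<close>
  are bounded. So all vectors that do at least as well as \<open>(1,\<dots>,1)\<close> lie in the compact set \<open>K\<close> of
  those \<open>x\<close> in a box for which \<open>(x * x)\<^sub>i\<close> obeys the lower bound wherever \<open>y\<^sub>i > 0\<close>. On \<open>K\<close> the
  divergence is finite and continuous, hence attains its minimum, and this minimum is global.\<close>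

text \<open>This is \<open>ln t \<le> t - 1\<close> at \<open>t = v / (2 u)\<close>; the factor \<open>2\<close> makes the logarithm absorb only
  half of the linear term \<open>v\<close>.\<close>

lemma divergence_term_ge_linear:
  fixes u v :: real
  assumes "u \<ge> 0" "v \<ge> 0" "v = 0 \<longrightarrow> u = 0"
  shows "v / 2 - u * ln 2 \<le> u * ln (u / v) - u + v"
proof (cases "u = 0")
  case True
  then show ?thesis using assms by simp
next
  case False
  with assms have pos: "u > 0" "v > 0" by auto
  have "u * ln (v / (2 * u)) \<le> u * (v / (2 * u) - 1)"
    using pos by (intro mult_left_mono ln_le_minus_one) auto
  also have "\<dots> = v / 2 - u" using pos by (simp add: field_simps)
  finally have "u * ln (v / (2 * u)) \<le> v / 2 - u" .
  moreover have "u * ln (u / v) = - (u * ln (v / (2 * u))) - u * ln 2"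
    using pos by (simp add: ln_div ln_mult algebra_simps)
  ultimately show ?thesis by linarith
qed

lemma divergence_term_nonneg:
  fixes u v :: real
  assumes "u \<ge> 0" "v \<ge> 0" "v = 0 \<longrightarrow> u = 0"
  shows "0 \<le> u * ln (u / v) - u + v"
proof (cases "u = 0")
  case True
  then show ?thesis using assms by simp
next
  case False
  with assms have pos: "u > 0" "v > 0" by auto
  have "u * ln (v / u) \<le> u * (v / u - 1)"
    using pos by (intro mult_left_mono ln_le_minus_one) auto
  also have "\<dots> = v - u" using pos by (simp add: field_simps)
  finally have "u * ln (v / u) \<le> v - u" .
  moreover have "ln (u / v) = - ln (v / u)"
    using pos by (simp add: ln_div)
  ultimately show ?thesis by (simp add: algebra_simps)
qed

lemma divergence_term_le_imp_lower:
  fixes u v M :: real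
  assumes "u > 0" "v > 0" "u * ln (u / v) - u + v \<le> M"
  shows "u * exp (- (M / u + 1)) \<le> v"
proof -
  have "u * ln (u / v) \<le> M + u" using assms by linarith
  then have "ln (u / v) \<le> M / u + 1"
    using assms(1) by (simp add: field_simps)
  then have "ln u + - (M / u + 1) \<le> ln v"
    using assms(1,2) by (simp add: ln_div)
  then have "exp (ln u + - (M / u + 1)) \<le> exp (ln v)" by (simp only: exp_le_cancel_iff)
  then show ?thesis
    using assms(1,2) by (simp only: exp_add exp_ln)
qed

text \<open>A finite bound on the sum bounds each summand, as the others are nonnegative; it also excludes
  the infinite case of the definition.\<close>

lemma divergence_term_le:
  assumes "\<forall>i\<le>n. 0 \<le> u i" "\<forall>i\<le>n. 0 \<le> v i"
    and le: "I_divergence n u v \<le> ereal M" and "i \<le> n"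
  shows "v i = 0 \<longrightarrow> u i = 0" "u i * ln (u i / v i) - u i + v i \<le> M"
proof -
  have ac: "\<forall>i\<le>n. v i = 0 \<longrightarrow> u i = 0"
    using le unfolding I_divergence_def by (auto split: if_splits)
  then show "v i = 0 \<longrightarrow> u i = 0" using \<open>i \<le> n\<close> by blast
  have "u i * ln (u i / v i) - u i + v i \<le> (\<Sum>i=0..n. u i * ln (u i / v i) - u i + v i)"
    using assms ac by (intro member_le_sum divergence_term_nonneg) auto
  also have "\<dots> \<le> M" using le ac unfolding I_divergence_def by simp
  finally show "u i * ln (u i / v i) - u i + v i \<le> M" .
qed

lemma self_conv_nonneg:
  assumes "x \<in> nonneg_vectors n" "i \<le> n"
  shows "0 \<le> self_conv n x i"
  using assms by (auto simp: self_conv_def nonneg_vectors_def PiE_iff intro!: sum_nonneg)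

lemma mult_first_le_self_conv:
  assumes "x \<in> nonneg_vectors n" "i \<le> n"
  shows "x 0 * x i \<le> self_conv n x i"
proof -
  have "x (i - i) * x i \<le> (\<Sum>j=0..i. x (i - j) * x j)"
    using assms by (intro member_le_sum[of i _ "\<lambda>j. x (i - j) * x j"])
      (auto simp: nonneg_vectors_def PiE_iff)
  then show ?thesis using assms(2) by (simp add: self_conv_def)
qed

lemma continuous_on_self_conv:
  assumes "i \<le> n"
  shows "continuous_on A (\<lambda>x. self_conv n x i)"
proof -
  have "continuous_on A (\<lambda>x. x k)" for k :: nat and A :: "(nat \<Rightarrow> real) set"
    by (rule continuous_on_product_then_coordinatewise[OF continuous_on_id])
  then have "continuous_on A (\<lambda>x. \<Sum>j=0..i. x (i - j) * x j)"
    by (intro continuous_intros)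
  then show ?thesis using assms by (simp add: self_conv_def)
qed

text \<open>Extensionality pins the coordinates outside \<open>I\<close> to a single point, so such a box is a full
  product of compact sets and Tychonoff's theorem applies.\<close>

lemma compact_PiE_Icc:
  fixes a b :: "'i \<Rightarrow> real"
  shows "compact (\<Pi>\<^sub>E i\<in>I. {a i..b i})"
proof -
  let ?S = "\<lambda>i. if i \<in> I then {a i..b i} else {undefined}"
  have "(\<Pi>\<^sub>E i\<in>I. {a i..b i}) = (\<Pi>\<^sub>E i\<in>UNIV. ?S i)"
    by (auto simp: PiE_iff extensional_def split: if_splits)
  moreover have "compactin (product_topology (\<lambda>i. euclidean) UNIV) (\<Pi>\<^sub>E i\<in>UNIV. ?S i)"
    by (subst compactin_PiE) auto
  ultimately show ?thesis
    by (simp add: euclidean_product_topology)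
qed

theorem proposition2p1:
  fixes n :: nat and y :: "nat \<Rightarrow> real"
  assumes "y \<in> nonneg_vectors n" and "y 0 > 0"
  shows "\<exists>xstar \<in> nonneg_vectors n. \<forall>x \<in> nonneg_vectors n.
           I_divergence n y (self_conv n xstar) \<le> I_divergence n y (self_conv n x)"
proof -
  have y_nonneg: "\<forall>i\<le>n. 0 \<le> y i" using assms(1) by (auto simp: nonneg_vectors_def PiE_iff)
  define F where "F x = (\<Sum>i=0..n. y i * ln (y i / self_conv n x i) - y i + self_conv n x i)" for x
  define ones :: "nat \<Rightarrow> real" where "ones = (\<lambda>i\<in>{..n}. 1)"
  define M where "M = F ones"
  \<comment> \<open>The bounds that a divergence of at most \<open>M\<close> forces: \<open>c i\<close> below \<open>(x * x)\<^sub>i\<close>; and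
    \<open>b i\<close> above \<open>x\<^sub>i\<close>, as the bound on \<open>(x * x)\<^sub>i\<close> divided by the one below \<open>x\<^sub>0\<close>.\<close>
  define c where "c i = y i * exp (- (M / y i + 1))" for i
  define b where "b i = 2 * (M + y i * ln 2) / sqrt (c 0)" for i
  define K where "K = (\<Pi>\<^sub>E i\<in>{..n}. {0..b i}) \<inter> {x. \<forall>i. i \<le> n \<and> 0 < y i \<longrightarrow> c i \<le> self_conv n x i}"

  have c_pos: "0 < c i" if "0 < y i" for i using that by (simp add: c_def)

  have ones_in: "ones \<in> nonneg_vectors n" by (auto simp: ones_def nonneg_vectors_def)
  have "self_conv n ones i = real i + 1" if "i \<le> n" for i
  proof -
    have "(\<Sum>j=0..i. ones (i - j) * ones j) = (\<Sum>j=0..i. 1)"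
      using that by (intro sum.cong) (auto simp: ones_def)
    then show ?thesis using that by (simp add: self_conv_def)
  qed
  then have div_ones: "I_divergence n y (self_conv n ones) = ereal M"
    by (auto simp: I_divergence_def M_def F_def)

  have K_nonneg: "x \<in> nonneg_vectors n" if "x \<in> K" for x
    using that by (auto simp: K_def nonneg_vectors_def PiE_iff)
  have div_K: "I_divergence n y (self_conv n x) = ereal (F x)" if "x \<in> K" for x
  proof -
    have "y i = 0" if i: "i \<le> n" "self_conv n x i = 0" for i
    proof (rule ccontr)
      assume "y i \<noteq> 0"
      then have "0 < y i" using y_nonneg i(1) by (simp add: order_less_le)
      then have "c i \<le> self_conv n x i" using \<open>x \<in> K\<close> i(1) by (simp add: K_def)
      then show False using i(2) c_pos[OF \<open>0 < y i\<close>] by simp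
    qed
    then show ?thesis by (auto simp: I_divergence_def F_def)
  qed

  have in_K: "x \<in> K"
    if x: "x \<in> nonneg_vectors n" and le: "I_divergence n y (self_conv n x) \<le> ereal M" for x
  proof -
    have v_nonneg: "\<forall>i\<le>n. 0 \<le> self_conv n x i" using self_conv_nonneg[OF x] by blast
    note summand = divergence_term_le[OF y_nonneg v_nonneg le]
    have lower: "c i \<le> self_conv n x i" if "i \<le> n" "0 < y i" for i
    proof -
      have "0 < self_conv n x i"
        using summand(1)[OF that(1)] that v_nonneg by (auto simp: order_less_le)
      then show ?thesis
        unfolding c_def using that summand(2) by (intro divergence_term_le_imp_lower) auto
    qed
    have x_nonneg: "0 \<le> x i" if "i \<le> n" for i
      using x that by (auto simp: nonneg_vectors_def PiE_iff)
    have "c 0 \<le> (x 0)\<^sup>2"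
      using lower[of 0] assms(2) by (simp add: self_conv_def power2_eq_square)
    then have root_le: "sqrt (c 0) \<le> x 0"
      using x_nonneg[of 0] by (simp add: real_le_lsqrt)
    have "x i \<le> b i" if "i \<le> n" for i
    proof -
      have "sqrt (c 0) * x i \<le> x 0 * x i"
        using root_le x_nonneg[OF that] by (rule mult_right_mono)
      also have "\<dots> \<le> self_conv n x i"
        by (rule mult_first_le_self_conv[OF x that])
      also have "\<dots> \<le> 2 * (M + y i * ln 2)"
        using divergence_term_ge_linear[of "y i" "self_conv n x i"] summand[OF that]
          that y_nonneg v_nonneg by simp
      finally show ?thesis
        using c_pos[OF assms(2)] by (simp add: b_def field_simps)
    qed
    then show ?thesis
      using x lower by (auto simp: K_def nonneg_vectors_def PiE_iff)
  qed

  \<comment> \<open>Closedness is where the weak inequality \<open>c i \<le> (x * x)\<^sub>i\<close> in \<open>K\<close> matters: the condition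
    \<open>(x * x)\<^sub>i > 0\<close> would also make the divergence continuous but is not closed.\<close>
  have "closed {x. \<forall>i. i \<le> n \<and> 0 < y i \<longrightarrow> c i \<le> self_conv n x i}"
  proof (intro closed_Collect_all)
    fix i
    show "closed {x. i \<le> n \<and> 0 < y i \<longrightarrow> c i \<le> self_conv n x i}"
      by (cases "i \<le> n \<and> 0 < y i")
        (auto intro!: closed_Collect_le continuous_on_self_conv continuous_on_const)
  qed
  then have "compact K"
    unfolding K_def by (intro compact_Int_closed compact_PiE_Icc)
  moreover have "ones \<in> K" using in_K[OF ones_in] div_ones by simp
  moreover have "continuous_on K F"
    unfolding F_def
  proof (intro continuous_on_sum continuous_on_add continuous_on_diff continuous_on_const)
    fix i assume "i \<in> {0..n}"
    then have i: "i \<le> n" by simp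
    show "continuous_on K (\<lambda>x. self_conv n x i)" by (rule continuous_on_self_conv[OF i])
    show "continuous_on K (\<lambda>x. y i * ln (y i / self_conv n x i))"
    proof (cases "y i = 0")
      case False
      then have "0 < y i" using y_nonneg i by (simp add: order_less_le)
      then have "c i \<le> self_conv n x i" if "x \<in> K" for x
        using that i by (simp add: K_def)
      then have "self_conv n x i \<noteq> 0" if "x \<in> K" for x
        using that c_pos[OF \<open>0 < y i\<close>] by force
      then show ?thesis using False
        by (intro continuous_intros continuous_on_self_conv[OF i]) auto
    qed simp
  qed
  ultimately obtain z where z: "z \<in> K" "\<forall>x\<in>K. F z \<le> F x"
    using continuous_attains_inf[of K F] by blast
  have "I_divergence n y (self_conv n z) \<le> I_divergence n y (self_conv n x)"
    if x: "x \<in> nonneg_vectors n" for x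
  proof (cases "I_divergence n y (self_conv n x) \<le> ereal M")
    case True
    then show ?thesis using in_K[OF x] z div_K by simp
  next
    case False
    have "F z \<le> M" using z(2) \<open>ones \<in> K\<close> by (simp add: M_def)
    then have "I_divergence n y (self_conv n z) \<le> ereal M" using div_K[OF z(1)] by simp
    with False show ?thesis by (meson order_trans linear)
  qed
  then show ?thesis using K_nonneg[OF z(1)] by blast
qed

end
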